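(* For the second order Padé approximants ${}_{[1|1]}H_n^{(1)}(x,-1)$, $n\ge 0$, of the Hermite polynomials of order one, the derivative and multiplicative operators are, respectively, $$ \hat P=\partial_x,\qquad \hat M=x-\frac{1}{1-\frac14\partial_x^2}. $$ That is, for every integer $n\ge0$, $$ \hat P\;{}_{[1|1]}H_n^{(1)}(x,-1)=n\;{}_{[1|1]}H_{n-1}^{(1)}(x,-1),\qquad \hat M\;{}_{[1|1]}H_n^{(1)}(x,-1)={}_{[1|1]}H_{n+1}^{(1)}(x,-1), $$ where for $n=0$ the right-hand side of the first identity is $0$.
   Context: The Hermite polynomials of order one are given by $\sum_{n\ge0}\frac{t^n}{n!}H_n^{(1)}(x,y)=e^{yt}e^{xt}$, so $H_n^{(1)}(x,-1)$ has Appell amplitude $A(t)=e^{-t}$. The Padé approximant ${}_{[1|1]}e^{-t}$ is the rational function with numerator and denominator of degree at most $1$, denominator equal to $1$ at $0$, whose derivatives at $0$ of orders $0,1,2$ agree with those of $e^{-t}$; explicitly ${}_{[1|1]}e^{-t}=\frac{1-\frac12t}{1+\frac12t}$. The polynomials ${}_{[1|1]}H_n^{(1)}(x,-1)$ are defined by $$\sum_{n\ge0}\frac{t^n}{n!}\,{}_{[1|1]}H_n^{(1)}(x,-1)=\frac{1-\frac12t}{1+\frac12t}\,e^{xt},\qquad\text{equivalently}\qquad {}_{[1|1]}H_n^{(1)}(x,-1)=\frac{1-\frac12\partial_x}{1+\frac12\partial_x}\{x^n\}.$$ Here $\partial_x=d/dx$, $x$ as an operator denotes multiplication by $x$, and a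 rational function of $\partial_x$ that is regular at $0$ acts on polynomials through its Maclaurin series (only finitely many terms contribute). For a sequence of polynomials $a_n(x)$, a derivative operator $\hat P$ and a multiplicative operator $\hat M$ are operators on polynomials with $\hat Pa_n(x)=na_{n-1}(x)$ and $\hat Ma_n(x)=a_{n+1}(x)$ for all $n\ge0$. *)

theory Defs
  imports "HOL-Computational_Algebra.Computational_Algebra"
begin

definition is_pade :: "nat \<Rightarrow> nat \<Rightarrow> 'a::field_char_0 fps \<Rightarrow> 'a fps \<Rightarrow> bool" where
  "is_pade m n f r \<longleftrightarrow>
     (\<exists>p q. degree p \<le> m \<and> degree q \<le> n \<and> poly q 0 = 1 \<and> r = fps_of_poly p / fps_of_poly q) \<and>
     (\<forall>k\<le>m+n. fps_nth ((fps_deriv ^^ k) r) 0 = fps_nth ((fps_deriv ^^ k) f) 0)"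

(* The \<open>[m|n]\<close> approximant, unique when it exists, as a power series in t. *)
definition pade :: "nat \<Rightarrow> nat \<Rightarrow> 'a::field_char_0 fps \<Rightarrow> 'a fps" where
  "pade m n f = (THE r. is_pade m n f r)"

(* n-th polynomial of the generating function A(t) exp(x t), taken as a power series in t
   over the polynomials in x. *)
definition appell_poly :: "'a::field_char_0 fps \<Rightarrow> nat \<Rightarrow> 'a poly" where
  "appell_poly A n = smult (fact n)
     (fps_nth (Abs_fps (\<lambda>k. [:fps_nth A k:]) * Abs_fps (\<lambda>k. smult (1 / fact k) ([:0, 1:] ^ k))) n)"

definition pade_hermite1 :: "nat \<Rightarrow> nat \<Rightarrow> 'a::field_char_0 \<Rightarrow> nat \<Rightarrow> 'a poly" where
  "pade_hermite1 k l y = appell_poly (pade k l (fps_exp y))"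

(* f(d/dx); the omitted terms vanish because higher derivatives of p are 0. *)
definition diff_op :: "'a::field_char_0 fps \<Rightarrow> 'a poly \<Rightarrow> 'a poly" where
  "diff_op f p = (\<Sum>k\<le>degree p. smult (fps_nth f k) ((pderiv ^^ k) p))"

definition derivative_operator ::
    "('a::field_char_0 poly \<Rightarrow> 'a poly) \<Rightarrow> (nat \<Rightarrow> 'a poly) \<Rightarrow> bool" where
  "derivative_operator P a \<longleftrightarrow>
     P (a 0) = 0 \<and> (\<forall>n\<ge>1. P (a n) = of_nat n * a (n - 1))"

definition multiplicative_operator ::
    "('a::field_char_0 poly \<Rightarrow> 'a poly) \<Rightarrow> (nat \<Rightarrow> 'a poly) \<Rightarrow> bool" where
  "multiplicative_operator M a \<longleftrightarrow> (\<forall>n. M (a n) = a (Suc n))"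

lemma fps_deriv_funpow_nth_0:
  "fps_nth ((fps_deriv ^^ k) (f :: 'a::field_char_0 fps)) 0 = fact k * fps_nth f k"
proof -
  have "fps_nth ((fps_deriv ^^ k) f) n = pochhammer (of_nat (Suc n)) k * fps_nth f (n + k)" for n
    by (induction k arbitrary: n) (simp_all add: pochhammer_rec algebra_simps)
  from this[of 0] show ?thesis by (simp add: pochhammer_fact)
qed

lemma pade_11_exp:
  "pade 1 1 (fps_exp (-1 :: 'a::field_char_0)) =
     (1 - fps_const (1/2) * fps_X) / (1 + fps_const (1/2) * fps_X)"
proof -
  let ?f = "fps_exp (-1 :: 'a)"
  let ?r = "(1 - fps_const (1/2) * fps_X) / (1 + fps_const (1/2) * fps_X) :: 'a fps"
  have iff: "is_pade 1 1 ?f r \<longleftrightarrow> r = ?r" for r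
  proof
    assume "is_pade 1 1 ?f r"
    then obtain p q :: "'a poly" where pq: "degree p \<le> 1" "degree q \<le> 1" "poly q 0 = 1"
      and r: "r = fps_of_poly p / fps_of_poly q"
      and eq: "\<And>k. k \<le> 2 \<Longrightarrow> fps_nth r k = fps_nth ?f k"
      unfolding is_pade_def fps_deriv_funpow_nth_0 one_add_one mult_cancel_left
      using fact_nonzero by metis
    have q0: "coeff q 0 = 1" using pq(3) by (simp add: poly_0_coeff_0)
    hence mul: "r * fps_of_poly q = fps_of_poly p"
      unfolding r by (subst fps_divide_unit) (auto simp: mult.assoc inverse_mult_eq_1)
    have c: "coeff p 2 = 0" "coeff q 2 = 0"
      using pq by (auto intro: coeff_eq_0)
    have nth: "fps_nth r 0 = 1" "fps_nth r 1 = -1" "fps_nth r 2 = 1/2"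
      using eq[of 0] eq[of 1] eq[of 2] by (simp_all add: power2_eq_square fact_2)
    have e: "fps_nth (r * fps_of_poly q) k = coeff p k" for k by (simp add: mul)
    have e2: "coeff q 1 = 1/2"
      using e[of 2] nth q0 c by (simp add: fps_mult_nth numeral_2_eq_2)
    have "coeff p 1 = coeff q 1 - 1" and e0: "coeff p 0 = 1"
      using e[of 1] e[of 0] nth q0 by (simp_all add: fps_mult_nth)
    hence e1: "coeff p 1 = -1/2" unfolding e2 by simp
    have lin: "a = [:coeff a 0, coeff a 1:]" if "degree a \<le> 1" for a :: "'a poly"
      using that by (intro poly_eqI) (auto simp: coeff_pCons coeff_eq_0 split: nat.splits)
    have "p = [:1, -1/2:]" "q = [:1, 1/2:]"
      using lin[OF pq(1)] lin[OF pq(2)] unfolding e0 e1 e2 q0 .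
    thus "r = ?r" unfolding r
      by (simp add: fps_of_poly_pCons fps_const_neg[symmetric] del: fps_const_neg)
  next
    assume r: "r = ?r"
    have pq: "r = fps_of_poly [:1, -1/2:] / fps_of_poly [:1, 1/2:]"
      unfolding r by (simp add: fps_of_poly_pCons fps_const_neg[symmetric] del: fps_const_neg)
    have mul: "r * (1 + fps_const (1/2) * fps_X) = 1 - fps_const (1/2) * fps_X"
      unfolding r by (subst fps_divide_unit) (auto simp: mult.assoc inverse_mult_eq_1)
    have e: "fps_nth r k + (if k = 0 then 0 else fps_nth r (k - 1) / 2) =
             fps_nth (1 - fps_const (1/2) * fps_X :: 'a fps) k" for k
      unfolding mul[symmetric] by (cases k) (simp_all add: algebra_simps)
    have n0: "fps_nth r 0 = 1" using e[of 0] by simp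
    have "fps_nth r 1 + 1/2 = -(1/2)" using e[of 1] n0 by simp
    hence "fps_nth r 1 = -(1/2) - 1/2" unfolding eq_diff_eq .
    hence n1: "fps_nth r 1 = -1" by simp
    have n2: "fps_nth r 2 = 1/2" using e[of 2] n1 by (simp add: field_simps)
    have "\<forall>k\<le>2. fps_nth r k = fps_nth ?f k"
      using n0 n1 n2 by (auto simp: le_Suc_eq numeral_2_eq_2)
    with pq show "is_pade 1 1 ?f r"
      unfolding is_pade_def fps_deriv_funpow_nth_0
      by (intro conjI exI[of _ "[:1, -1/2:]"] exI[of _ "[:1, 1/2:]"]) auto
  qed
  show ?thesis unfolding pade_def iff by simp
qed

lemma appell_poly_generating:
  "Abs_fps (\<lambda>n. poly (appell_poly A n) x / fact n) = A * fps_exp x"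
  by (rule fps_ext) (simp add: appell_poly_def fps_mult_nth poly_sum)

lemma appell_poly_eq_diff_op: "appell_poly A n = diff_op A (monom 1 n)"
proof -
  have d: "(pderiv ^^ k) (monom 1 n :: 'a poly) = smult (fact n / fact (n - k)) (monom 1 (n - k))"
    if "k \<le> n" for k
    using that
  proof (induction k)
    case (Suc k)
    then have "n - k = Suc (n - Suc k)" by simp
    with Suc show ?case
      by (simp add: pderiv_smult pderiv_monom smult_monom del: of_nat_Suc)
  qed simp
  have smult_sum_r: "smult c (\<Sum>k\<in>S. g k) = (\<Sum>k\<in>S. smult c (g k))"
    for c :: 'a and g :: "nat \<Rightarrow> 'a poly" and S
    by (induction S rule: infinite_finite_induct) (simp_all add: smult_add_right)
  have "diff_op A (monom 1 n) = (\<Sum>k\<le>n. smult (fps_nth A k * (fact n / fact (n - k))) (monom 1 (n - k)))"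
    unfolding diff_op_def by (simp add: degree_monom_eq d)
  also have "\<dots> = appell_poly A n"
    unfolding appell_poly_def
    by (simp add: fps_mult_nth atLeast0AtMost smult_sum_r monom_altdef mult_ac)
  finally show ?thesis ..
qed

end

theory Submission
  imports Defs
begin

text \<open>
  For any amplitude \<open>A\<close>, the coefficient of \<open>x^i\<close> in the \<open>n\<close>-th Appell polynomial is
  \<open>n!/i!\<close> times the \<open>(n - i)\<close>-th coefficient of \<open>A\<close>. Hence \<open>d/dx\<close> is a derivative operator,
  and \<open>x + (A'/A)(d/dx)\<close> is a multiplicative one, because differentiating \<open>A(t) exp(x t)\<close> in \<open>t\<close>
  multiplies it by \<open>x + A'(t)/A(t)\<close>. For \<open>A = (1 - t/2)/(1 + t/2)\<close> the logarithmic derivative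
  is \<open>-1/(1 - t^2/4)\<close>.
\<close>

lemma coeff_appell_poly:
  fixes A :: "'a::field_char_0 fps"
  shows "coeff (appell_poly A n) i = (if i \<le> n then fact n / fact i * fps_nth A (n - i) else 0)"
proof -
  have X: "[:0, 1:] ^ k = (monom 1 k :: 'a poly)" for k by (simp add: monom_altdef)
  \<comment> \<open>The guard \<open>i \<le> n\<close> is needed because truncated subtraction would
    otherwise select \<open>j = 0\<close> when \<open>i > n\<close>.\<close>
  have "coeff (appell_poly A n) i =
      fact n * (\<Sum>j\<le>n. if j = n - i \<and> i \<le> n then fps_nth A j / fact i else 0)"
    unfolding appell_poly_def
    by (auto simp: X fps_mult_nth coeff_sum atLeast0AtMost smult_monom intro!: sum.cong)
  then show ?thesis by (cases "i \<le> n") simp_all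
qed

lemma degree_appell_poly_le: "degree (appell_poly A n) \<le> n"
  by (rule degree_le) (simp add: coeff_appell_poly)

lemma pderiv_appell_poly_0: "pderiv (appell_poly A 0) = 0"
  by (rule poly_eqI) (simp add: coeff_pderiv coeff_appell_poly)

lemma pderiv_appell_poly_Suc:
  "pderiv (appell_poly A (Suc n)) = of_nat (Suc n) * appell_poly A n"
  by (rule poly_eqI)
    (simp add: coeff_pderiv coeff_appell_poly of_nat_poly divide_simps del: of_nat_Suc)

lemma derivative_operator_appell_poly: "derivative_operator pderiv (appell_poly A)"
  unfolding derivative_operator_def
  by (metis pderiv_appell_poly_0 pderiv_appell_poly_Suc Suc_pred' less_eq_Suc_le One_nat_def diff_Suc_1)

text \<open>The Appell polynomial has degree below \<open>n\<close> when \<open>A\<close> has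
  constant term 0, so a summation bound independent of the exact degree is convenient. The extra
  derivatives vanish.\<close>

lemma diff_op_eq_sum:
  assumes "degree p \<le> n"
  shows "diff_op f p = (\<Sum>k\<le>n. smult (fps_nth f k) ((pderiv ^^ k) p))"
  unfolding diff_op_def using assms
  by (intro sum.mono_neutral_left)
    (auto intro!: poly_eqI simp: coeff_higher_pderiv coeff_eq_0)

lemma diff_op_uminus: "diff_op (- f) p = - diff_op f p"
  by (simp add: diff_op_def sum_negf)

text \<open>In generating functions, d/dx multiplies A(t) exp(x t) by t, hence B(d/dx) multiplies it
  by B(t).\<close>

lemma diff_op_appell_poly:
  fixes A B :: "'a::field_char_0 fps"
  shows "diff_op B (appell_poly A n) = appell_poly (B * A) n"
proof (rule poly_eqI)
  fix i
  \<comment> \<open>This is the factor produced by \<open>k\<close> differentiations; its numerator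
    cancels the \<open>fact (i + k)\<close> in \<open>coeff_appell_poly\<close>.\<close>
  have poch: "pochhammer (1 + of_nat i) k = (fact (i + k) / fact i :: 'a)" for k
    using pochhammer_product[of i "i + k" "1 :: 'a"] by (simp add: pochhammer_fact[symmetric])
  have "coeff (diff_op B (appell_poly A n)) i =
      (\<Sum>k\<le>n. fps_nth B k * (fact (i + k) / fact i * coeff (appell_poly A n) (i + k)))"
    by (simp add: diff_op_eq_sum[OF degree_appell_poly_le] coeff_sum coeff_higher_pderiv poch)
  also have "\<dots> = (\<Sum>k\<le>n. if i + k \<le> n
      then fact n / fact i * (fps_nth B k * fps_nth A (n - i - k)) else 0)"
    by (intro sum.cong) (auto simp: coeff_appell_poly)
  also have "\<dots> = (\<Sum>k | k \<le> n \<and> i + k \<le> n.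
      fact n / fact i * (fps_nth B k * fps_nth A (n - i - k)))"
    by (simp add: sum.inter_filter[symmetric] conj_commute)
  also have "\<dots> = coeff (appell_poly (B * A) n) i"
  proof (cases "i \<le> n")
    case True
    \<comment> \<open>Exactly the range of the Cauchy product for coefficient \<open>n - i\<close>
      of \<open>B * A\<close>.\<close>
    then have "{k. k \<le> n \<and> i + k \<le> n} = {0..n - i}" by auto
    then show ?thesis using True
      by (simp add: coeff_appell_poly fps_mult_nth sum_distrib_left)
  next
    case False
    then have "{k. k \<le> n \<and> i + k \<le> n} = {}" by auto
    then show ?thesis using False by (simp add: coeff_appell_poly del: Collect_empty_eq)
  qed
  finally show "coeff (diff_op B (appell_poly A n)) i = coeff (appell_poly (B * A) n) i" .
qed

text \<open>Compare coefficients of t^n/n! in the t-derivative of A(t) exp(x t), by the product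
  rule.\<close>

lemma appell_poly_Suc:
  fixes A :: "'a::field_char_0 fps"
  shows "appell_poly A (Suc n) = [:0, 1:] * appell_poly A n + appell_poly (fps_deriv A) n"
proof (rule poly_eqI)
  fix i
  show "coeff (appell_poly A (Suc n)) i =
      coeff ([:0, 1:] * appell_poly A n + appell_poly (fps_deriv A) n) i"
  proof (cases i)
    case 0
    then show ?thesis by (simp add: coeff_appell_poly algebra_simps)
  next
    case (Suc j)
    consider "j < n" | "j = n" | "j > n" by linarith
    then show ?thesis
    proof cases
      case 1
      \<comment> \<open>The part \<open>Suc j\<close> accounts for multiplication by x, the part
        \<open>n - j\<close> is the factor from differentiating \<open>A\<close>.\<close>
      then have "(of_nat (Suc n) :: 'a) = of_nat (Suc j) + of_nat (n - j)"
        by (simp flip: of_nat_add)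
      moreover have "(fact n / fact j :: 'a) = of_nat (Suc j) * (fact n / fact (Suc j))"
        by (simp add: divide_simps del: of_nat_Suc)
      moreover have "Suc (n - Suc j) = n - j" using 1 by simp
      ultimately show ?thesis using Suc 1
        by (simp add: coeff_appell_poly fact_Suc[of n] algebra_simps add_divide_distrib
            del: fact_Suc)
    qed (use Suc in \<open>simp_all add: coeff_appell_poly del: fact_Suc\<close>)
  qed
qed

text \<open>Here \<open>B\<close> stands for A'/A; the product form avoids division by
  \<open>A\<close>.\<close>

lemma multiplicative_operator_appell_poly:
  assumes "fps_deriv A = B * A"
  shows "multiplicative_operator (\<lambda>p. [:0, 1:] * p + diff_op B p) (appell_poly A)"
  unfolding multiplicative_operator_def diff_op_appell_poly assms[symmetric]
  by (simp only: appell_poly_Suc) simp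

text \<open>With h = t/2, A'/A = -h'/(1 - h) - h'/(1 + h) = -2h'/(1 - h^2), and 2h' = 1. The proof
  clears all denominators.\<close>

lemma fps_deriv_pade_11_exp:
  fixes A :: "'a::field_char_0 fps"
  defines "A \<equiv> (1 - fps_const (1/2) * fps_X) / (1 + fps_const (1/2) * fps_X)"
  shows "fps_deriv A = - (1 / (1 - fps_const (1/4) * fps_X ^ 2)) * A"
proof -
  define h :: "'a fps" where "h = fps_const (1/2) * fps_X"
  let ?u = "1 + h" and ?v = "1 - h"
  have h0: "fps_nth h 0 = 0" by (simp add: h_def)
  have h': "fps_deriv h = fps_const (1/2)" by (simp add: h_def)
  have hh: "fps_const (1/4) * fps_X ^ 2 = h ^ 2"
    by (simp add: h_def power_mult_distrib fps_const_power power2_eq_square)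
  have sq: "1 - h ^ 2 = ?u * ?v" by (simp add: algebra_simps power2_eq_square)
  have u0: "?u \<noteq> 0" and v0: "?v \<noteq> 0"
    using h0 by (auto simp: fps_eq_iff intro!: exI[of _ 0])
  have Au: "A * ?u = ?v"
    unfolding A_def h_def[symmetric] using h0
    by (subst fps_divide_unit) (auto simp: mult.assoc inverse_mult_eq_1)
  have inv: "(1 / (1 - h ^ 2)) * (?u * ?v) = 1"
    unfolding sq using h0 by (subst fps_divide_unit) (auto simp: inverse_mult_eq_1)
  have "fps_deriv (A * ?u) = - fps_const (1/2)"
    unfolding Au by (simp add: h')
  then have d: "fps_deriv A * ?u + A * fps_const (1/2) = - fps_const (1/2)"
    by (simp add: h' mult.commute add.commute)
  have half: "fps_const (1/2) + fps_const (1/2) = (1 :: 'a fps)"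
    by (simp add: fps_const_add)
  \<comment> \<open>The second factor \<open>?u\<close> eliminates \<open>A\<close> through
    \<open>Au\<close>; then \<open>?u + ?v = 2\<close> leaves a constant.\<close>
  have "fps_deriv A * ?u * ?u = - fps_const (1/2) * ?u - fps_const (1/2) * (A * ?u)"
    using d by algebra
  also have "\<dots> = - (fps_const (1/2) + fps_const (1/2))"
    unfolding Au by algebra
  finally have "fps_deriv A * ?u * ?u = -1" unfolding half .
  \<comment> \<open>Both sides equal \<open>- ?v\<close>: on the right, \<open>?u * ?v\<close>
    cancels the inverse and the other \<open>?u\<close> turns \<open>A\<close> into
    \<open>?v\<close>.\<close>
  then have "fps_deriv A * (?u * ?u * ?v) = - (1 / (1 - h ^ 2)) * A * (?u * ?u * ?v)"
    using inv Au by algebra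
  moreover have "?u * ?u * ?v \<noteq> 0" using u0 v0 by (metis no_zero_divisors)
  ultimately show ?thesis unfolding hh by (metis mult_right_cancel)
qed

theorem theorem4:
  shows "derivative_operator pderiv (pade_hermite1 1 1 (-1 :: 'a::field_char_0)) \<and>
         multiplicative_operator
           (\<lambda>p. [:0, 1:] * p - diff_op (1 / (1 - fps_const (1/4) * fps_X ^ 2)) p)
           (pade_hermite1 1 1 (-1 :: 'a))"
  using multiplicative_operator_appell_poly[OF fps_deriv_pade_11_exp, where ?'a = 'a]
  by (simp only: pade_hermite1_def pade_11_exp diff_op_uminus derivative_operator_appell_poly
      add_uminus_conv_diff simp_thms)

end
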